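(* Let $K>0$, $\gamma>1$, and let $T\in(0,\infty]$. Let $(u(x,t),\tau(x,t))$, $\tau>0$, be a $C^1$ solution of the isentropic Euler equations in Lagrangian coordinates $$\tau_t-u_x=0,\qquad u_t+p_x=0,\qquad p=K\tau^{-\gamma},$$ in the region $(x,t)\in\mathbb R\times[0,T)$. Put $\rho=1/\tau$, $\eta=\frac{2\sqrt{K\gamma}}{\gamma-1}\tau^{-\frac{\gamma-1}{2}}$, $\alpha=u_x+\eta_x$ and $\beta=u_x-\eta_x$. Assume that $u(x,0)$, $\tau(x,0)>0$, $\rho(x,0)=1/\tau(x,0)$, $\alpha(x,0)$ and $\beta(x,0)$ are all uniformly bounded in $x\in\mathbb R$, and let $M$ be a constant with $\max_{x\in\mathbb R}\{\alpha(x,0),\beta(x,0)\}<M$. Then, in Eulerian coordinates $(y,t)$, $$\max_{(y,t)\in\mathbb R\times[0,T)}\Big\{\frac{u_y}{\rho}\Big\}<M,$$ and there is a constant $\bar M$ independent of $T$ such that $$\max_{(y,t)\in\mathbb R\times[0,T)}\{u_y\}<\bar M.$$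
   Context: Here $u$ is the velocity, $\rho$ the density, $\tau=1/\rho$ the specific volume, $p$ the pressure. The Eulerian spatial coordinate $y$ is related to the Lagrangian coordinate $x$ by the standard change of variables $y=y(x,t)$ with $y_x=\tau$ and $y_t=u$ (e.g. $y(x,t)=\int_0^x\tau(\xi,0)\,d\xi+\int_0^t u(x,s)\,ds$); functions of $(x,t)$ are regarded as functions of $(y,t)$ through it, and then $\rho\,u_x(x,t)=u_y(y,t)$. Maxima over non-compact sets are understood as suprema; $\max\{\alpha,\beta\}$ over a set means the supremum over the set of both functions. *)

theory Defs
  imports "HOL-Analysis.Analysis" "HOL-Library.Extended_Real"
begin

definition time_dom :: "ereal \<Rightarrow> real set" where
  "time_dom T = {t. 0 \<le> t \<and> ereal t < T}"

definition Dx :: "(real \<Rightarrow> real \<Rightarrow> real) \<Rightarrow> real \<Rightarrow> real \<Rightarrow> real" where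
  "Dx f x t = deriv (\<lambda>\<xi>. f \<xi> t) x"

text \<open>Taken within the time domain, so that it is the one-sided derivative at \<open>t = 0\<close>.\<close>

definition Dt :: "ereal \<Rightarrow> (real \<Rightarrow> real \<Rightarrow> real) \<Rightarrow> real \<Rightarrow> real \<Rightarrow> real" where
  "Dt T f x t = vector_derivative (\<lambda>s. f x s) (at t within time_dom T)"

text \<open>\<open>C\<^sup>1\<close> up to and including the boundary \<open>t = 0\<close>.\<close>

definition C1_strip :: "ereal \<Rightarrow> (real \<Rightarrow> real \<Rightarrow> real) \<Rightarrow> bool" where
  "C1_strip T f \<longleftrightarrow>
     (\<forall>x. \<forall>t\<in>time_dom T.
        (\<lambda>\<xi>. f \<xi> t) differentiable (at x) \<and>
        (\<lambda>s. f x s) differentiable (at t within time_dom T)) \<and>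
     continuous_on (UNIV \<times> time_dom T) (\<lambda>(x, t). f x t) \<and>
     continuous_on (UNIV \<times> time_dom T) (\<lambda>(x, t). Dx f x t) \<and>
     continuous_on (UNIV \<times> time_dom T) (\<lambda>(x, t). Dt T f x t)"

definition pressure :: "real \<Rightarrow> real \<Rightarrow> real \<Rightarrow> real" where
  "pressure K \<gamma> v = K * v powr (- \<gamma>)"

definition eta :: "real \<Rightarrow> real \<Rightarrow> real \<Rightarrow> real" where
  "eta K \<gamma> v = 2 * sqrt (K * \<gamma>) / (\<gamma> - 1) * v powr (- ((\<gamma> - 1) / 2))"

definition euler_solution ::
  "real \<Rightarrow> real \<Rightarrow> ereal \<Rightarrow> (real \<Rightarrow> real \<Rightarrow> real) \<Rightarrow> (real \<Rightarrow> real \<Rightarrow> real) \<Rightarrow> bool" where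
  "euler_solution K \<gamma> T u \<tau> \<longleftrightarrow>
     C1_strip T u \<and> C1_strip T \<tau> \<and>
     (\<forall>x. \<forall>t\<in>time_dom T.
        \<tau> x t > 0 \<and>
        Dt T \<tau> x t - Dx u x t = 0 \<and>
        Dt T u x t + Dx (\<lambda>x t. pressure K \<gamma> (\<tau> x t)) x t = 0)"

text \<open>\<open>\<alpha>\<close> and \<open>\<beta>\<close> at a fixed time, as functions of the spatial profiles of \<open>u\<close> and \<open>\<tau>\<close>
  at that time.\<close>

definition alpha :: "real \<Rightarrow> real \<Rightarrow> (real \<Rightarrow> real) \<Rightarrow> (real \<Rightarrow> real) \<Rightarrow> real \<Rightarrow> real" where
  "alpha K \<gamma> v w x = deriv v x + deriv (\<lambda>\<xi>. eta K \<gamma> (w \<xi>)) x"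

definition beta :: "real \<Rightarrow> real \<Rightarrow> (real \<Rightarrow> real) \<Rightarrow> (real \<Rightarrow> real) \<Rightarrow> real \<Rightarrow> real" where
  "beta K \<gamma> v w x = deriv v x - deriv (\<lambda>\<xi>. eta K \<gamma> (w \<xi>)) x"

text \<open>The coordinate change \<open>y = Y x t\<close>, which \<open>y\<^sub>x = \<tau>\<close> and \<open>y\<^sub>t = u\<close> determine up to an additive
  constant.\<close>

definition eulerian_coordinate ::
  "ereal \<Rightarrow> (real \<Rightarrow> real \<Rightarrow> real) \<Rightarrow> (real \<Rightarrow> real \<Rightarrow> real) \<Rightarrow> (real \<Rightarrow> real \<Rightarrow> real) \<Rightarrow> bool" where
  "eulerian_coordinate T u \<tau> Y \<longleftrightarrow>
     (\<forall>x. \<forall>t\<in>time_dom T.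
        ((\<lambda>\<xi>. Y \<xi> t) has_real_derivative \<tau> x t) (at x) \<and>
        ((\<lambda>s. Y x s) has_real_derivative u x t) (at t within time_dom T))"

text \<open>A function of \<open>(x, t)\<close> regarded as a function of \<open>(y, t)\<close>. This is meaningful when every
  \<open>\<lambda>x. Y x t\<close> is a bijection of the real line, which is the case when \<open>\<tau>\<close> is bounded away
  from \<open>0\<close> at each time.\<close>

definition to_eulerian ::
  "(real \<Rightarrow> real \<Rightarrow> real) \<Rightarrow> (real \<Rightarrow> real \<Rightarrow> real) \<Rightarrow> real \<Rightarrow> real \<Rightarrow> real" where
  "to_eulerian Y f y t = f (inv (\<lambda>x. Y x t) y) t"

end

theory Submission
  imports Defs
begin

text \<open>
  With \<open>c = sqrt (K \<gamma>) \<tau> powr (- (\<gamma> + 1) / 2)\<close> the (Lagrangian) sound speed, the Riemann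
  invariants \<open>w = u + \<eta>\<close> and \<open>z = u - \<eta>\<close> satisfy \<open>w\<^sub>t + c w\<^sub>x = 0\<close> and \<open>z\<^sub>t - c z\<^sub>x = 0\<close>, and
  \<open>\<alpha> = w\<^sub>x\<close>, \<open>\<beta> = z\<^sub>x\<close>. Formally \<open>\<alpha>\<close> and \<open>\<beta>\<close> solve Riccati equations along characteristics, with
  right-hand sides \<open>k \<alpha> (\<beta> - \<alpha>)\<close> and \<open>k \<beta> (\<alpha> - \<beta>)\<close>, \<open>k > 0\<close>, so that a common nonnegative upper
  bound persists: the larger of the two cannot grow. As the solution is only \<open>C\<^sup>1\<close>, \<open>\<alpha>\<close> and \<open>\<beta>\<close>
  cannot be differentiated. The same cancellation is therefore read off finite differences.
  Suppose \<open>max (w y - w x) (z y - z x) - m (y - x)\<close> peaks at a positive value, where \<open>x < y\<close> and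
  \<open>m \<ge> 0\<close>. If the difference of \<open>w\<close> attains the maximum, then \<open>\<eta> y \<ge> \<eta> x\<close>, so \<open>c y \<ge> c x\<close>; the
  forward characteristics through \<open>x\<close> and \<open>y\<close> separate, \<open>m (y - x)\<close> does not decrease along
  them, and the peak cannot have been reached from below. If the difference of \<open>z\<close> attains it,
  then \<open>c y \<le> c x\<close> and the backward characteristics separate. This is
  \<open>transported_pair_slope_le\<close>.

  Characteristics need not be constructed. In a maximum principle (\<open>no_positive_peak\<close>) only
  the behaviour at the peak matters, and there the straight segment tangent to the
  characteristic serves as well. Compactness comes from backward cones, which contain such
  segments as soon as their slope dominates \<open>c\<close>. That \<open>c\<close> is bounded at all is
  \<open>specific_volume_lower_bound\<close>: the initial upper bounds for \<open>w\<close> and \<open>-z\<close> persist, hence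
  \<open>\<eta> = (w - z) / 2\<close> stays bounded and \<open>\<tau>\<close> stays above a positive constant that depends on the
  initial data only.

  An upper bound \<open>m\<close> for \<open>\<alpha>\<close> at time \<open>0\<close> is automatically nonnegative, because \<open>w\<close> is bounded on
  the whole line at that time. Averaging the bounds for the slopes of \<open>w\<close> and \<open>z\<close> gives
  \<open>u\<^sub>x \<le> m\<close>; since \<open>u\<^sub>y = u\<^sub>x / \<tau>\<close> and \<open>u\<^sub>y / \<rho> = u\<^sub>x\<close>, both conclusions follow.
\<close>

section \<open>A maximum principle along backward curves\<close>

text \<open>At a maximum of \<open>G (q, t) - \<epsilon> t\<close>, a curve into the past along which \<open>G\<close> is bounded below by
  some \<open>F\<close> that touches it at the maximum forces \<open>D + \<epsilon> \<le> 0\<close> for the slope \<open>D\<close> of \<open>F\<close>. The lower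
  function \<open>F\<close> makes the principle applicable to a maximum of two differentiable functions,
  which itself need not be differentiable.\<close>

lemma no_positive_peak:
  fixes S :: "('a::metric_space \<times> real) set" and G :: "'a \<times> real \<Rightarrow> real"
  assumes "compact S" and "continuous_on S G"
    and time: "\<And>q t. (q, t) \<in> S \<Longrightarrow> 0 \<le> t"
    and curve: "\<And>q t. (q, t) \<in> S \<Longrightarrow> G (q, t) > 0 \<Longrightarrow>
      \<exists>r F D d. 0 < d \<and> 0 \<le> D \<and> F 0 = G (q, t) \<and>
        (F has_real_derivative D) (at 0 within {0..d}) \<and>
        (\<forall>s\<in>{0..d}. (r s, t - s) \<in> S \<and> F s \<le> G (r s, t - s))"
    and p: "p \<in> S"
  shows "G p \<le> 0"
proof (rule ccontr)
  assume "\<not> G p \<le> 0"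
  then have Gp: "G p > 0" by simp
  have tp: "snd p \<ge> 0" using time[of "fst p" "snd p"] p by simp
  \<comment> \<open>The penalty is small enough to keep \<open>G p - \<epsilon> * snd p\<close> positive.\<close>
  define \<epsilon> where "\<epsilon> = G p / (2 * (snd p + 1))"
  have e: "\<epsilon> > 0" using Gp tp by (simp add: \<epsilon>_def)
  have "\<epsilon> * (snd p + 1) = G p / 2" using tp by (simp add: \<epsilon>_def field_simps)
  then have below: "\<epsilon> * snd p < G p" using Gp e by (simp add: distrib_left)
  have "continuous_on S (\<lambda>p. G p - \<epsilon> * snd p)"
    using assms(2) by (intro continuous_intros)
  moreover have "S \<noteq> {}" using p by auto
  ultimately obtain q where q: "q \<in> S" "\<And>p. p \<in> S \<Longrightarrow> G p - \<epsilon> * snd p \<le> G q - \<epsilon> * snd q"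
    using continuous_attains_sup[OF assms(1)] by blast
  obtain x t where xt: "q = (x, t)" by (cases q)
  have "G (x, t) - \<epsilon> * t > 0" using q(2)[OF p] below xt by simp
  moreover have "0 \<le> \<epsilon> * t" using time[of x t] q(1) xt e by simp
  ultimately have "G (x, t) > 0" by linarith
  then obtain r F D d where F: "0 < d" "0 \<le> D" "F 0 = G (x, t)"
      "(F has_real_derivative D) (at 0 within {0..d})"
      "\<And>s. s \<in> {0..d} \<Longrightarrow> (r s, t - s) \<in> S \<and> F s \<le> G (r s, t - s)"
    using curve[of x t] q(1) xt by blast
  have "((\<lambda>s. F s - \<epsilon> * (t - s)) has_real_derivative D + \<epsilon>) (at 0 within {0..d})"
    by (auto intro!: derivative_eq_intros F(4))
  from has_real_derivative_pos_inc_right[OF this] F(2) e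
  obtain k where k: "k > 0" "\<And>h. h > 0 \<Longrightarrow> h \<in> {0..d} \<Longrightarrow> h < k \<Longrightarrow>
      F 0 - \<epsilon> * t < F h - \<epsilon> * (t - h)" by auto
  define h where "h = min d (k / 2)"
  have h: "h > 0" "h \<in> {0..d}" "h < k" using F(1) k(1) by (auto simp: h_def)
  have "F h - \<epsilon> * (t - h) \<le> F 0 - \<epsilon> * t"
    using F(5)[OF h(2)] q(2)[of "(r h, t - h)"] F(3) xt by auto
  with k(2)[OF h] show False by simp
qed

section \<open>Transported functions on backward cones\<close>

lemma continuous_on_compose_strip:
  assumes "continuous_on (UNIV \<times> J) (\<lambda>(x, t). f x t)"
    and "continuous_on S g" "continuous_on S h" "\<And>p. p \<in> S \<Longrightarrow> h p \<in> J"
  shows "continuous_on S (\<lambda>p. f (g p) (h p))"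
proof -
  have "continuous_on S (\<lambda>p. (\<lambda>(x, t). f x t) (g p, h p))"
    by (rule continuous_on_compose2[OF assms(1)])
      (use assms in \<open>auto intro!: continuous_intros\<close>)
  then show ?thesis by simp
qed

text \<open>The equation \<open>w\<^sub>t + c w\<^sub>x = 0\<close> for \<open>0 < t \<le> a\<close>, stated through one-sided derivatives along the
  straight segments tangent to the characteristics. Looking backwards in time only, it makes
  sense up to the final time \<open>a\<close>.\<close>

definition transported ::
  "real \<Rightarrow> (real \<Rightarrow> real \<Rightarrow> real) \<Rightarrow> (real \<Rightarrow> real \<Rightarrow> real) \<Rightarrow> bool" where
  "transported a c w \<longleftrightarrow>
     continuous_on (UNIV \<times> {0..a}) (\<lambda>(x, t). w x t) \<and>
     (\<forall>x t. 0 < t \<longrightarrow> t \<le> a \<longrightarrow>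
        ((\<lambda>s. w (x - c x t * s) (t - s)) has_real_derivative 0) (at 0 within {0..t}))"

lemma transportedD:
  assumes "transported a c w"
  shows "continuous_on (UNIV \<times> {0..a}) (\<lambda>(x, t). w x t)"
    and "0 < t \<Longrightarrow> t \<le> a \<Longrightarrow>
      ((\<lambda>s. w (x - c x t * s) (t - s)) has_real_derivative 0) (at 0 within {0..t})"
  using assms by (auto simp: transported_def)

lemma transported_uminus:
  assumes "transported a c w"
  shows "transported a c (\<lambda>x t. - w x t)"
  unfolding transported_def
proof (intro conjI allI impI)
  show "continuous_on (UNIV \<times> {0..a}) (\<lambda>(x, t). - w x t)"
    using transportedD(1)[OF assms] by (simp add: case_prod_unfold continuous_on_minus)
  show "((\<lambda>s. - w (x - c x t * s) (t - s)) has_real_derivative 0) (at 0 within {0..t})"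
    if "0 < t" "t \<le> a" for x t
    using DERIV_minus[OF transportedD(2)[OF assms that, of x]] by simp
qed

definition backward_cone :: "real \<Rightarrow> real \<Rightarrow> real \<Rightarrow> (real \<times> real) set" where
  "backward_cone C x0 t0 = {(x, t). 0 \<le> t \<and> t \<le> t0 \<and> \<bar>x - x0\<bar> \<le> C * (t0 - t)}"

lemma compact_backward_cone:
  assumes "C \<ge> 0"
  shows "compact (backward_cone C x0 t0)"
  unfolding compact_eq_bounded_closed
proof
  have eq: "backward_cone C x0 t0 = {p. 0 \<le> snd p} \<inter> {p. snd p \<le> t0} \<inter>
      {p. \<bar>fst p - x0\<bar> \<le> C * (t0 - snd p)}"
    by (auto simp: backward_cone_def)
  show "closed (backward_cone C x0 t0)"
    unfolding eq by (intro closed_Int closed_Collect_le continuous_intros)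
  have "backward_cone C x0 t0 \<subseteq> {x0 - C * t0..x0 + C * t0} \<times> {0..t0}"
  proof (clarify, goal_cases)
    case (1 x t)
    moreover from this have "C * (t0 - t) \<le> C * t0"
      using assms by (intro mult_left_mono) (auto simp: backward_cone_def)
    ultimately show ?case by (auto simp: backward_cone_def)
  qed
  then show "bounded (backward_cone C x0 t0)"
    by (rule bounded_subset[rotated]) (intro bounded_Times bounded_closed_interval)
qed

text \<open>Going back in time, the cone widens at speed \<open>C\<close>, at least as fast as the segment moves.\<close>

lemma backward_cone_step:
  assumes "(x, t) \<in> backward_cone C x0 t0" "\<bar>v\<bar> \<le> C" "0 \<le> s" "s \<le> t"
  shows "(x - v * s, t - s) \<in> backward_cone C x0 t0"
proof -
  have "\<bar>v * s\<bar> \<le> C * s" using assms by (simp add: abs_mult mult_right_mono)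
  then show ?thesis using assms by (auto simp: backward_cone_def algebra_simps)
qed

lemma transported_le_initial:
  assumes w: "transported a c w" and t0: "0 \<le> t0" "t0 \<le> a"
    and C: "0 \<le> C" "\<And>x t. (x, t) \<in> backward_cone C x0 t0 \<Longrightarrow> \<bar>c x t\<bar> \<le> C"
    and init: "\<And>x. w x 0 \<le> N"
  shows "w x0 t0 \<le> N"
proof -
  let ?S = "backward_cone C x0 t0" and ?G = "\<lambda>(x, t). w x t - N"
  have cont: "continuous_on ?S (\<lambda>(x, t). w x t)"
    by (rule continuous_on_subset[OF transportedD(1)[OF w]])
      (use t0(2) in \<open>auto simp: backward_cone_def\<close>)
  have "?G (x0, t0) \<le> 0"
  proof (rule no_positive_peak[of ?S])
    show "compact ?S" using C(1) by (rule compact_backward_cone)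
    show "continuous_on ?S ?G"
      using cont by (auto simp: case_prod_unfold intro!: continuous_intros)
    show "0 \<le> t" if "(x, t) \<in> ?S" for x t using that by (simp add: backward_cone_def)
    show "(x0, t0) \<in> ?S" using t0 by (simp add: backward_cone_def)
    fix x t assume S: "(x, t) \<in> ?S" and pos: "?G (x, t) > 0"
    then have t: "0 < t" "t \<le> a" using init[of x] t0 by (auto simp: backward_cone_def less_le)
    have "((\<lambda>s. w (x - c x t * s) (t - s) - N) has_real_derivative 0) (at 0 within {0..t})"
      using DERIV_diff[OF transportedD(2)[OF w t, of x] DERIV_const[of N]] by simp
    then show "\<exists>r F D d. 0 < d \<and> 0 \<le> D \<and> F 0 = ?G (x, t) \<and>
        (F has_real_derivative D) (at 0 within {0..d}) \<and>
        (\<forall>s\<in>{0..d}. (r s, t - s) \<in> ?S \<and> F s \<le> ?G (r s, t - s))"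
      using t(1) backward_cone_step[OF S C(2)[OF S]]
      by (intro exI[of _ "\<lambda>s. x - c x t * s"] exI[of _ "\<lambda>s. w (x - c x t * s) (t - s) - N"]
          exI[of _ 0] exI[of _ t]) auto
  qed
  then show ?thesis by simp
qed

section \<open>Slopes of a pair of oppositely transported functions\<close>

text \<open>Ordered pairs of points at a common time in the domain of dependence of \<open>[l, r]\<close> at time \<open>t0\<close>.\<close>

definition backward_wedge :: "real \<Rightarrow> real \<Rightarrow> real \<Rightarrow> real \<Rightarrow> ((real \<times> real) \<times> real) set" where
  "backward_wedge C l r t0 = {((x, y), t). 0 \<le> t \<and> t \<le> t0 \<and> x \<le> y \<and>
     l - C * (t0 - t) \<le> x \<and> y \<le> r + C * (t0 - t)}"

lemma compact_backward_wedge: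
  assumes "C \<ge> 0"
  shows "compact (backward_wedge C l r t0)"
  unfolding compact_eq_bounded_closed
proof
  have eq: "backward_wedge C l r t0 = {p. 0 \<le> snd p} \<inter> {p. snd p \<le> t0} \<inter>
      {p. fst (fst p) \<le> snd (fst p)} \<inter> {p. l - C * (t0 - snd p) \<le> fst (fst p)} \<inter>
      {p. snd (fst p) \<le> r + C * (t0 - snd p)}"
    by (auto simp: backward_wedge_def)
  show "closed (backward_wedge C l r t0)"
    unfolding eq by (intro closed_Int closed_Collect_le continuous_intros)
  let ?I = "{l - C * t0..r + C * t0}"
  have "backward_wedge C l r t0 \<subseteq> (?I \<times> ?I) \<times> {0..t0}"
  proof (clarify, goal_cases)
    case (1 x y t)
    moreover from this have "C * (t0 - t) \<le> C * t0"
      using assms by (intro mult_left_mono) (auto simp: backward_wedge_def)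
    ultimately show ?case by (auto simp: backward_wedge_def)
  qed
  then show "bounded (backward_wedge C l r t0)"
    by (rule bounded_subset[rotated]) (intro bounded_Times bounded_closed_interval)
qed

text \<open>The two points approach each other at relative speed at most \<open>2 C\<close>, so their order is kept for
  a short time; the summand \<open>1\<close> in the denominator only covers \<open>C = 0\<close>.\<close>

lemma backward_wedge_step:
  assumes S: "((x, y), t) \<in> backward_wedge C l r t0" and "\<bar>v\<bar> \<le> C" "\<bar>v'\<bar> \<le> C" "0 \<le> C"
    and s: "0 \<le> s" "s \<le> min t ((y - x) / (2 * C + 1))"
  shows "((x - v * s, y - v' * s), t - s) \<in> backward_wedge C l r t0"
proof -
  have "\<bar>v * s\<bar> \<le> C * s" "\<bar>v' * s\<bar> \<le> C * s" using assms by (auto simp: abs_mult mult_right_mono)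
  moreover have "s * (2 * C + 1) \<le> y - x" using s assms(4) by (simp add: field_simps)
  ultimately show ?thesis using S s by (auto simp: backward_wedge_def algebra_simps)
qed

text \<open>A substitute for the Riccati comparison that uses first derivatives only. The hypothesis
  on \<open>c\<close> expresses genuine nonlinearity: the speed is an increasing function of \<open>w - z\<close>. At a
  point where the difference of \<open>w\<close> is at least that of \<open>z\<close>, this makes the two characteristics
  of \<open>w\<close> diverge forwards in time, and symmetrically for \<open>z\<close>.\<close>

lemma transported_pair_slope_le:
  fixes w z c :: "real \<Rightarrow> real \<Rightarrow> real"
  assumes w: "transported a c w" and z: "transported a (\<lambda>x t. - c x t) z"
    and t0: "0 \<le> t0" "t0 \<le> a"
    and C: "0 \<le> C" "\<And>x t. 0 \<le> t \<Longrightarrow> t \<le> a \<Longrightarrow> \<bar>c x t\<bar> \<le> C"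
    and mono: "\<And>x y t. 0 \<le> t \<Longrightarrow> t \<le> a \<Longrightarrow> w x t - z x t \<le> w y t - z y t \<Longrightarrow> c x t \<le> c y t"
    and m: "0 \<le> m"
    and init: "\<And>x y. x \<le> y \<Longrightarrow> w y 0 - w x 0 \<le> m * (y - x)"
      "\<And>x y. x \<le> y \<Longrightarrow> z y 0 - z x 0 \<le> m * (y - x)"
    and lr: "l \<le> r"
  shows "w r t0 - w l t0 \<le> m * (r - l)" and "z r t0 - z l t0 \<le> m * (r - l)"
proof -
  let ?S = "backward_wedge C l r t0"
  define P where "P f = (\<lambda>((x, y), t). f y t - f x t - m * (y - x))"
    for f :: "real \<Rightarrow> real \<Rightarrow> real"
  let ?G = "\<lambda>p. max (P w p) (P z p)"
  have contP: "continuous_on ?S (P f)" if "transported a c' f" for f c'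
  proof -
    have f: "continuous_on (UNIV \<times> {0..a}) (\<lambda>(x, t). f x t)"
      using that by (rule transportedD(1))
    have sub: "snd p \<in> {0..a}" if "p \<in> ?S" for p
      using that t0(2) by (auto simp: backward_wedge_def)
    have "continuous_on ?S (\<lambda>p. f (snd (fst p)) (snd p))"
      using sub by (intro continuous_on_compose_strip[OF f] continuous_intros) auto
    moreover have "continuous_on ?S (\<lambda>p. f (fst (fst p)) (snd p))"
      using sub by (intro continuous_on_compose_strip[OF f] continuous_intros) auto
    ultimately show ?thesis
      unfolding P_def case_prod_unfold by (intro continuous_intros)
  qed
  have derivP: "((\<lambda>s. P f ((x - c' x t * s, y - c' y t * s), t - s)) has_real_derivative
      m * (c' y t - c' x t)) (at 0 within {0..d})"
    if f: "transported a c' f" and t: "0 < t" "t \<le> a" "d \<le> t" for f c' x y t d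
  proof -
    have "((\<lambda>s. m * ((y - c' y t * s) - (x - c' x t * s))) has_real_derivative
        m * (c' x t - c' y t)) (at 0 within {0..t})"
      by (auto intro!: derivative_eq_intros)
    from DERIV_diff[OF DERIV_diff[OF transportedD(2)[OF f t(1,2), of y]
          transportedD(2)[OF f t(1,2), of x]] this]
    have "((\<lambda>s. P f ((x - c' x t * s, y - c' y t * s), t - s)) has_real_derivative
        m * (c' y t - c' x t)) (at 0 within {0..t})"
      by (simp add: P_def algebra_simps)
    then show ?thesis by (rule DERIV_subset) (use t in auto)
  qed
  have "?G ((l, r), t0) \<le> 0"
  proof (rule no_positive_peak[of ?S])
    show "compact ?S" using C(1) by (rule compact_backward_wedge)
    show "continuous_on ?S ?G" using contP[OF w] contP[OF z] by (intro continuous_on_max)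
    show "0 \<le> t" if "(q, t) \<in> ?S" for q t using that by (auto simp: backward_wedge_def)
    show "((l, r), t0) \<in> ?S" using t0 lr by (simp add: backward_wedge_def)
    fix q t assume S: "(q, t) \<in> ?S" and pos: "?G (q, t) > 0"
    obtain x y where q: "q = (x, y)" by (cases q)
    have t: "0 \<le> t" "t \<le> a" and xy: "x \<le> y" using S q t0 by (auto simp: backward_wedge_def)
    have "t \<noteq> 0" using pos init[OF xy] by (auto simp: q P_def)
    then have tpos: "0 < t" using t by simp
    have "x \<noteq> y" using pos by (auto simp: q P_def)
    then have "x < y" using xy by simp
    define d where "d = min t ((y - x) / (2 * C + 1))"
    have d: "0 < d" "d \<le> t" using tpos \<open>x < y\<close> C(1) by (auto simp: d_def)
    have step: "\<exists>r F D d. 0 < d \<and> 0 \<le> D \<and> F 0 = ?G (q, t) \<and>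
        (F has_real_derivative D) (at 0 within {0..d}) \<and>
        (\<forall>s\<in>{0..d}. (r s, t - s) \<in> ?S \<and> F s \<le> ?G (r s, t - s))"
      if f: "transported a c' f" and f_max: "P f (q, t) = ?G (q, t)" and f_le: "\<And>p. P f p \<le> ?G p"
        and c': "c' x t \<le> c' y t" "\<bar>c' x t\<bar> \<le> C" "\<bar>c' y t\<bar> \<le> C" for f c'
    proof -
      have "((x - c' x t * s, y - c' y t * s), t - s) \<in> ?S" if "s \<in> {0..d}" for s
        using that S c'(2,3) C(1) by (intro backward_wedge_step) (auto simp: q d_def)
      then show ?thesis
        using derivP[OF f tpos t(2) d(2), of x y] d c'(1) m f_max f_le
        by (intro exI[of _ "\<lambda>s. (x - c' x t * s, y - c' y t * s)"]
            exI[of _ "\<lambda>s. P f ((x - c' x t * s, y - c' y t * s), t - s)"]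
            exI[of _ "m * (c' y t - c' x t)"] exI[of _ d]) (auto simp: q)
    qed
    show "\<exists>r F D d. 0 < d \<and> 0 \<le> D \<and> F 0 = ?G (q, t) \<and>
        (F has_real_derivative D) (at 0 within {0..d}) \<and>
        (\<forall>s\<in>{0..d}. (r s, t - s) \<in> ?S \<and> F s \<le> ?G (r s, t - s))"
    proof (cases "P z (q, t) \<le> P w (q, t)")
      case True
      then have "c x t \<le> c y t" by (intro mono t) (simp add: q P_def)
      with True show ?thesis using C(2)[OF t] by (intro step[OF w]) auto
    next
      case False
      then have "c y t \<le> c x t" by (intro mono t) (simp add: q P_def)
      with False show ?thesis using C(2)[OF t] by (intro step[OF z]) auto
    qed
  qed
  then show "w r t0 - w l t0 \<le> m * (r - l)" "z r t0 - z l t0 \<le> m * (r - l)"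
    by (auto simp: P_def)
qed


section \<open>\<open>C\<^sup>1\<close> functions on the strip\<close>

lemma time_dom_downward: "t \<in> time_dom T \<Longrightarrow> {0..t} \<subseteq> time_dom T"
proof
  fix s assume "t \<in> time_dom T" "s \<in> {0..t}"
  then have "0 \<le> s" "ereal s \<le> ereal t" "ereal t < T" by (simp_all add: time_dom_def)
  then show "s \<in> time_dom T" unfolding time_dom_def using le_less_trans by blast
qed

lemma C1_stripD:
  assumes "C1_strip T f" "t \<in> time_dom T"
  shows "((\<lambda>\<xi>. f \<xi> t) has_real_derivative Dx f x t) (at x)"
    and "((\<lambda>s. f x s) has_real_derivative Dt T f x t) (at t within time_dom T)"
proof -
  have "(\<lambda>\<xi>. f \<xi> t) differentiable (at x)"
    "(\<lambda>s. f x s) differentiable (at t within time_dom T)"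
    using assms by (auto simp: C1_strip_def)
  then show "((\<lambda>\<xi>. f \<xi> t) has_real_derivative Dx f x t) (at x)"
    "((\<lambda>s. f x s) has_real_derivative Dt T f x t) (at t within time_dom T)"
    unfolding Dx_def Dt_def has_real_derivative_iff_has_vector_derivative[of "\<lambda>s. f x s"]
    by (simp_all only: DERIV_deriv_iff_real_differentiable vector_derivative_works)
qed

lemma C1_strip_continuous_on:
  assumes "C1_strip T f" "a \<in> time_dom T"
  shows "continuous_on (UNIV \<times> {0..a}) (\<lambda>(x, t). f x t)"
  using assms time_dom_downward[OF assms(2)]
  by (auto simp: C1_strip_def intro: continuous_on_subset)

text \<open>Continuity of the \<open>x\<close>-derivative makes the partial derivatives add up to a total derivative,
  relative to the time domain.\<close>

lemma C1_strip_backward_derivative: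
  assumes f: "C1_strip T f" and t: "t \<in> time_dom T"
  shows "((\<lambda>s. f (x - v * s) (t - s)) has_real_derivative - (v * Dx f x t + Dt T f x t))
    (at 0 within {0..t})"
proof -
  let ?J = "time_dom T"
  have "continuous_on (?J \<times> UNIV) (\<lambda>p. Dx f (snd p) (fst p))"
  proof -
    have "continuous_on (UNIV \<times> ?J) (\<lambda>(x, t). Dx f x t)"
      using f by (simp add: C1_strip_def)
    then show ?thesis by (rule continuous_on_compose_strip) (auto intro!: continuous_intros)
  qed
  then have cont: "continuous_on (?J \<times> UNIV) (\<lambda>(t, x). blinfun_mult_right (Dx f x t))"
    unfolding case_prod_unfold
    by (rule bounded_linear.continuous_on[OF bounded_linear_blinfun_mult_right])
  have "((\<lambda>(t, x). f x t) has_derivative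
      (\<lambda>(k, h). Dt T f x t * k + Dx f x t * h)) (at (t, x) within ?J \<times> UNIV)"
  proof (rule has_derivative_partialsI[where fy = "\<lambda>t x. blinfun_mult_right (Dx f x t)",
        unfolded blinfun_mult_right.rep_eq])
    show "((\<lambda>t. f x t) has_derivative (*) (Dt T f x t)) (at t within ?J)"
      using C1_stripD(2)[OF f t] by (simp add: has_field_derivative_def)
    show "((\<lambda>x. f x t) has_derivative (*) (Dx f x t)) (at x within UNIV)"
      if "t \<in> ?J" for t x
      using C1_stripD(1)[OF f that] by (simp add: has_field_derivative_def)
    show "continuous (at (t, x) within ?J \<times> UNIV) (\<lambda>(t, x). blinfun_mult_right (Dx f x t))"
      using cont t by (simp add: continuous_on_eq_continuous_within)
  qed auto
  then have "((\<lambda>(t, x). f x t) has_derivative (\<lambda>(k, h). Dt T f x t * k + Dx f x t * h))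
      (at (t - 0, x - v * 0) within (\<lambda>s. (t - s, x - v * s)) ` {0..t})"
    unfolding diff_zero mult_zero_right
    by (rule has_derivative_subset) (use time_dom_downward[OF t] in auto)
  moreover have "((\<lambda>s. (t - s, x - v * s)) has_derivative (\<lambda>h. (- h, - (v * h))))
      (at 0 within {0..t})"
    by (auto intro!: derivative_eq_intros)
  ultimately have "((\<lambda>s. (\<lambda>(t, x). f x t) (t - s, x - v * s)) has_derivative
      (\<lambda>h. (\<lambda>(k, h). Dt T f x t * k + Dx f x t * h) (- h, - (v * h)))) (at 0 within {0..t})"
    by (rule has_derivative_in_compose[rotated])
  then have "((\<lambda>s. f (x - v * s) (t - s)) has_derivative
      (\<lambda>h. Dt T f x t * (- h) + Dx f x t * (- (v * h)))) (at 0 within {0..t})"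
    by (simp only: prod.case)
  then show ?thesis
    by (rule has_derivative_imp_has_field_derivative) (simp add: algebra_simps)
qed

section \<open>The gas law and the Riemann invariants\<close>

text \<open>The square root of \<open>- p'(v)\<close>, which is also \<open>- \<eta>'(v)\<close>; see \<open>DERIV_pressure\<close> and \<open>DERIV_eta\<close>.\<close>

definition sound_speed :: "real \<Rightarrow> real \<Rightarrow> real \<Rightarrow> real" where
  "sound_speed K \<gamma> v = sqrt (K * \<gamma>) * v powr (- ((\<gamma> + 1) / 2))"

lemma sound_speed_nonneg: "K > 0 \<Longrightarrow> \<gamma> > 1 \<Longrightarrow> 0 \<le> sound_speed K \<gamma> v"
  by (simp add: sound_speed_def)

lemma sound_speed_antimono:
  assumes "K > 0" "\<gamma> > 1" "0 < v" "v \<le> v'"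
  shows "sound_speed K \<gamma> v' \<le> sound_speed K \<gamma> v"
  unfolding sound_speed_def using assms by (intro mult_left_mono powr_mono2') auto

lemma DERIV_eta:
  assumes "K > 0" "\<gamma> > 1" "0 < v"
  shows "(eta K \<gamma> has_real_derivative - sound_speed K \<gamma> v) (at v)"
proof -
  have "- ((\<gamma> - 1) / 2) - 1 = - ((\<gamma> + 1) / 2)" by (simp add: field_simps)
  then have "2 * sqrt (K * \<gamma>) / (\<gamma> - 1) * (- ((\<gamma> - 1) / 2) * v powr (- ((\<gamma> - 1) / 2) - 1)) =
      - sound_speed K \<gamma> v"
    using assms(2) by (simp add: sound_speed_def)
  with DERIV_cmult[OF has_real_derivative_powr[OF assms(3), of "- ((\<gamma> - 1) / 2)"],
      of "2 * sqrt (K * \<gamma>) / (\<gamma> - 1)"]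
  show ?thesis unfolding eta_def[abs_def] by simp
qed

lemma DERIV_pressure:
  assumes "K > 0" "\<gamma> > 1" "0 < v"
  shows "(pressure K \<gamma> has_real_derivative - (sound_speed K \<gamma> v)\<^sup>2) (at v)"
proof -
  have "(v powr (- ((\<gamma> + 1) / 2)))\<^sup>2 = v powr (- \<gamma> - 1)"
    by (simp add: power2_eq_square add_divide_distrib flip: powr_add)
  then have "(sound_speed K \<gamma> v)\<^sup>2 = K * \<gamma> * v powr (- \<gamma> - 1)"
    using assms by (simp add: sound_speed_def power_mult_distrib)
  with DERIV_cmult[OF has_real_derivative_powr[OF assms(3), of "- \<gamma>"], of K]
  show ?thesis unfolding pressure_def[abs_def] by (simp add: mult.assoc)
qed

lemma eta_strict_antimono:
  assumes "K > 0" "\<gamma> > 1" "0 < v" "v < v'"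
  shows "eta K \<gamma> v' < eta K \<gamma> v"
  unfolding eta_def using assms by (intro mult_strict_left_mono powr_less_mono2_neg) auto

lemma eta_le_iff:
  assumes "K > 0" "\<gamma> > 1" "0 < v" "0 < v'"
  shows "eta K \<gamma> v \<le> eta K \<gamma> v' \<longleftrightarrow> v' \<le> v"
  using eta_strict_antimono[OF assms(1,2), of v v'] eta_strict_antimono[OF assms(1,2), of v' v]
    assms(3,4) by (cases v v' rule: linorder_cases) auto

lemma eta_pos: "K > 0 \<Longrightarrow> \<gamma> > 1 \<Longrightarrow> 0 < v \<Longrightarrow> 0 < eta K \<gamma> v"
  by (simp add: eta_def)

lemma eta_surj:
  assumes "K > 0" "\<gamma> > 1" "0 < N"
  obtains v where "0 < v" "eta K \<gamma> v = N"
proof -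
  let ?k = "2 * sqrt (K * \<gamma>) / (\<gamma> - 1)"
  let ?v = "(N / ?k) powr (- (2 / (\<gamma> - 1)))"
  have k: "?k > 0" using assms by simp
  have "?v powr (- ((\<gamma> - 1) / 2)) = N / ?k"
  proof -
    have "- (2 / (\<gamma> - 1)) * - ((\<gamma> - 1) / 2) = 1" using assms by simp
    then show ?thesis using assms k unfolding powr_powr by (simp only: powr_one) simp
  qed
  then have "eta K \<gamma> ?v = ?k * (N / ?k)" unfolding eta_def by (rule arg_cong)
  also have "\<dots> = N" using k by (metis less_irrefl nonzero_mult_div_cancel_left times_divide_eq_right)
  finally have "eta K \<gamma> ?v = N" .
  moreover have "0 < ?v" using assms k by simp
  ultimately show ?thesis by (rule that[rotated])
qed

lemma euler_solutionD:
  assumes "K > 0" "\<gamma> > 1" and sol: "euler_solution K \<gamma> T u \<tau>" and t: "t \<in> time_dom T"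
  shows "\<tau> x t > 0" and "Dt T \<tau> x t = Dx u x t"
    and "Dt T u x t = (sound_speed K \<gamma> (\<tau> x t))\<^sup>2 * Dx \<tau> x t"
proof -
  show pos: "\<tau> x t > 0" and "Dt T \<tau> x t = Dx u x t"
    using sol t by (auto simp: euler_solution_def)
  have "C1_strip T \<tau>" using sol by (simp add: euler_solution_def)
  from DERIV_chain2[OF DERIV_pressure[OF assms(1,2) pos] C1_stripD(1)[OF this t]]
  have "Dx (\<lambda>x t. pressure K \<gamma> (\<tau> x t)) x t = - (sound_speed K \<gamma> (\<tau> x t))\<^sup>2 * Dx \<tau> x t"
    unfolding Dx_def by (rule DERIV_imp_deriv)
  moreover have "Dt T u x t + Dx (\<lambda>x t. pressure K \<gamma> (\<tau> x t)) x t = 0"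
    using sol t by (simp add: euler_solution_def)
  ultimately show "Dt T u x t = (sound_speed K \<gamma> (\<tau> x t))\<^sup>2 * Dx \<tau> x t"
    by simp
qed

lemma continuous_on_eta:
  assumes K: "K > 0" "\<gamma> > 1" and sol: "euler_solution K \<gamma> T u \<tau>" and a: "a \<in> time_dom T"
  shows "continuous_on (UNIV \<times> {0..a}) (\<lambda>(x, t). eta K \<gamma> (\<tau> x t))"
proof -
  have "continuous_on {0<..} (eta K \<gamma>)"
    by (rule DERIV_continuous_on) (use DERIV_eta[OF K] in \<open>auto intro: DERIV_subset\<close>)
  moreover have "continuous_on (UNIV \<times> {0..a}) (\<lambda>p. \<tau> (fst p) (snd p))"
    using sol C1_strip_continuous_on[OF _ a, of \<tau>]
    by (simp add: euler_solution_def case_prod_unfold)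
  ultimately show ?thesis
    unfolding case_prod_unfold
    by (rule continuous_on_compose2)
      (use euler_solutionD(1)[OF K sol] time_dom_downward[OF a] in auto)
qed

text \<open>The sign \<open>\<sigma>\<close> treats both invariants at once. With \<open>\<eta>\<^sub>t = - c u\<^sub>x\<close> and \<open>u\<^sub>t = c\<^sup>2 \<tau>\<^sub>x\<close>, the
  terms in \<open>u\<^sub>x\<close> cancel, and what remains is a multiple of \<open>\<sigma>\<^sup>2 - 1\<close>.\<close>

lemma riemann_invariant_transported:
  assumes K: "K > 0" "\<gamma> > 1" and sol: "euler_solution K \<gamma> T u \<tau>" and a: "a \<in> time_dom T"
    and \<sigma>: "\<sigma> * \<sigma> = 1"
  shows "transported a (\<lambda>x t. \<sigma> * sound_speed K \<gamma> (\<tau> x t)) (\<lambda>x t. u x t + \<sigma> * eta K \<gamma> (\<tau> x t))"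
  unfolding transported_def
proof (intro conjI allI impI)
  have C1: "C1_strip T u" "C1_strip T \<tau>" using sol by (auto simp: euler_solution_def)
  note sub = time_dom_downward[OF a]
  show "continuous_on (UNIV \<times> {0..a}) (\<lambda>(x, t). u x t + \<sigma> * eta K \<gamma> (\<tau> x t))"
    using C1_strip_continuous_on[OF C1(1) a] continuous_on_eta[OF K sol a]
    unfolding case_prod_unfold by (intro continuous_intros)
  fix x t :: real assume "0 < t" "t \<le> a"
  then have t: "t \<in> time_dom T" using sub by auto
  let ?c = "sound_speed K \<gamma> (\<tau> x t)"
  note du = C1_strip_backward_derivative[OF C1(1) t, of x "\<sigma> * ?c"]
  note d\<tau> = C1_strip_backward_derivative[OF C1(2) t, of x "\<sigma> * ?c"]
  have "(eta K \<gamma> has_real_derivative - ?c) (at (\<tau> (x - \<sigma> * ?c * 0) (t - 0)))"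
    using DERIV_eta[OF K euler_solutionD(1)[OF K sol t]] by simp
  from DERIV_add[OF du DERIV_cmult[OF DERIV_chain2[OF this d\<tau>], of \<sigma>]]
  have "((\<lambda>s. u (x - \<sigma> * ?c * s) (t - s) + \<sigma> * eta K \<gamma> (\<tau> (x - \<sigma> * ?c * s) (t - s)))
      has_real_derivative - (\<sigma> * ?c * Dx u x t + ?c\<^sup>2 * Dx \<tau> x t) +
        \<sigma> * (- ?c * - (\<sigma> * ?c * Dx \<tau> x t + Dx u x t))) (at 0 within {0..t})"
    by (simp add: euler_solutionD[OF K sol t])
  also have "- (\<sigma> * ?c * Dx u x t + ?c\<^sup>2 * Dx \<tau> x t) +
      \<sigma> * (- ?c * - (\<sigma> * ?c * Dx \<tau> x t + Dx u x t)) = (\<sigma> * \<sigma> - 1) * ?c\<^sup>2 * Dx \<tau> x t"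
    by (simp add: algebra_simps power2_eq_square)
  finally show "((\<lambda>s. u (x - \<sigma> * ?c * s) (t - s) + \<sigma> * eta K \<gamma> (\<tau> (x - \<sigma> * ?c * s) (t - s)))
      has_real_derivative 0) (at 0 within {0..t})"
    using \<sigma> by simp
qed

lemma riemann_invariants_transported:
  assumes "K > 0" "\<gamma> > 1" "euler_solution K \<gamma> T u \<tau>" "a \<in> time_dom T"
  shows "transported a (\<lambda>x t. sound_speed K \<gamma> (\<tau> x t)) (\<lambda>x t. u x t + eta K \<gamma> (\<tau> x t))"
    and "transported a (\<lambda>x t. - sound_speed K \<gamma> (\<tau> x t)) (\<lambda>x t. u x t - eta K \<gamma> (\<tau> x t))"
  using riemann_invariant_transported[OF assms, of 1]
    riemann_invariant_transported[OF assms, of "-1"] by simp_all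

section \<open>A lower bound for the specific volume\<close>

text \<open>The bound \<open>\<eta> \<le> N\<close> would follow from the transport equations on a cone on which the sound
  speed is controlled, but that control itself needs a bound for \<open>\<eta>\<close>. The circle is broken by
  looking at the first time when \<open>\<eta>\<close> reaches \<open>N + 1\<close> in a cone whose slope is the sound speed at
  \<open>\<eta> = N + 1\<close>: in the cone below that point the speed is at most the slope, so that \<open>\<eta> \<le> N\<close> at the
  point itself.\<close>

lemma specific_volume_lower_bound:
  assumes K: "K > 0" "\<gamma> > 1" and sol: "euler_solution K \<gamma> T u \<tau>" and t: "t \<in> time_dom T"
    and init: "\<And>x. u x 0 + eta K \<gamma> (\<tau> x 0) \<le> N" "\<And>x. eta K \<gamma> (\<tau> x 0) - u x 0 \<le> N"
    and \<delta>: "0 < \<delta>" "eta K \<gamma> \<delta> = N + 1"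
  shows "\<delta> \<le> \<tau> x t"
proof (rule ccontr)
  let ?h = "\<lambda>x t. eta K \<gamma> (\<tau> x t)" and ?c = "\<lambda>x t. sound_speed K \<gamma> (\<tau> x t)"
  define C where "C = sound_speed K \<gamma> \<delta>"
  have C: "0 \<le> C" using K by (simp add: C_def sound_speed_nonneg)
  have h_iff: "?h x s \<le> N + 1 \<longleftrightarrow> \<delta> \<le> \<tau> x s" if "s \<in> {0..t}" for x s
    using eta_le_iff[OF K euler_solutionD(1)[OF K sol, of s x] \<delta>(1)] that
      time_dom_downward[OF t] \<delta>(2) by auto
  assume "\<not> \<delta> \<le> \<tau> x t"
  have t0: "0 \<le> t" using t by (simp add: time_dom_def)
  note h_cont = continuous_on_eta[OF K sol t]
  define B where "B = {p \<in> backward_cone C x t. N + 1 \<le> ?h (fst p) (snd p)}"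
  have cone: "backward_cone C x t \<subseteq> UNIV \<times> {0..t}" by (auto simp: backward_cone_def)
  have "continuous_on (backward_cone C x t) (\<lambda>p. ?h (fst p) (snd p))"
    using cone by (intro continuous_on_compose_strip[OF h_cont] continuous_intros) auto
  from closed_vimage_Int[OF closed_atLeast[of "N + 1"] this
      compact_imp_closed[OF compact_backward_cone[OF C]]]
  have "closed B" by (simp add: B_def vimage_def Int_def conj_commute)
  moreover have "B = backward_cone C x t \<inter> B" by (auto simp: B_def)
  ultimately have "compact B" by (metis compact_Int_closed compact_backward_cone C)
  moreover have "(x, t) \<in> B"
    using \<open>\<not> \<delta> \<le> \<tau> x t\<close> h_iff[of t x] t0 by (auto simp: B_def backward_cone_def)
  then have "B \<noteq> {}" by auto
  ultimately obtain p where p: "p \<in> B" "\<And>q. q \<in> B \<Longrightarrow> snd p \<le> snd q"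
    using continuous_attains_inf[of B snd] continuous_on_snd[OF continuous_on_id] by blast
  obtain x1 t1 where p_eq: "p = (x1, t1)" by (cases p)
  have t1: "0 \<le> t1" "t1 \<le> t" and x1: "\<bar>x1 - x\<bar> \<le> C * (t - t1)" and h1: "N + 1 \<le> ?h x1 t1"
    using p(1) by (auto simp: p_eq B_def backward_cone_def)
  have cone1: "backward_cone C x1 t1 \<subseteq> backward_cone C x t"
    using t1 x1 by (auto simp: backward_cone_def algebra_simps)
  have before: "?h y s \<le> N + 1" if "(y, s) \<in> backward_cone C x1 t1" "s < t1" for y s
    using p(2)[of "(y, s)"] that cone1 by (force simp: p_eq B_def)
  have "t1 \<noteq> 0" using init[of x1] h1 by auto
  then have "0 < t1" using t1 by simp
  \<comment> \<open>Minimality of the time says nothing about the apex itself, which is reached by continuity.\<close>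
  have apex: "?h x1 t1 \<le> N + 1"
  proof (rule continuous_le_on_closure[of "{0..<t1}" "?h x1"])
    show "t1 \<in> closure {0..<t1}" using \<open>0 < t1\<close> by simp
    show "continuous_on (closure {0..<t1}) (?h x1)"
      using t1 \<open>0 < t1\<close>
      by (intro continuous_on_compose_strip[OF h_cont] continuous_intros) auto
    show "?h x1 s \<le> N + 1" if "s \<in> {0..<t1}" for s
      using that C by (intro before) (auto simp: backward_cone_def)
  qed
  have slow: "\<bar>?c y s\<bar> \<le> C" if S: "(y, s) \<in> backward_cone C x1 t1" for y s
  proof -
    have s: "s \<in> {0..t}" "s \<le> t1" using S t1 by (auto simp: backward_cone_def)
    have "?h y s \<le> N + 1"
      using S apex before[OF S] s by (cases "s = t1") (auto simp: backward_cone_def)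
    then have "\<delta> \<le> \<tau> y s" using h_iff s by blast
    then show ?thesis
      unfolding C_def using sound_speed_antimono[OF K \<delta>(1)] sound_speed_nonneg[OF K]
      by (simp add: abs_of_nonneg)
  qed
  note tr = riemann_invariants_transported[OF K sol t]
  have "u x1 t1 + ?h x1 t1 \<le> N"
    by (rule transported_le_initial[OF tr(1) t1 C slow init(1)])
  moreover have "- (u x1 t1 - ?h x1 t1) \<le> N"
    by (rule transported_le_initial[OF transported_uminus[OF tr(2)] t1 C])
      (use slow init(2) in auto)
  ultimately show False using h1 by simp
qed


section \<open>The upper bound for the velocity gradient\<close>

lemma slope_le_of_DERIV_le:
  fixes f :: "real \<Rightarrow> real"
  assumes "\<And>x. (f has_real_derivative f' x) (at x)" "\<And>x. f' x \<le> m" "x \<le> y"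
  shows "f y - f x \<le> m * (y - x)"
proof (cases "x = y")
  case False
  then obtain z where "f y - f x = (y - x) * f' z"
    using MVT2[of x y f f'] assms(1,3) by auto
  then show ?thesis using assms(2)[of z] assms(3) by (simp add: mult_right_mono mult.commute[of "y - x"])
qed simp

lemma DERIV_le_of_slope_le:
  fixes f :: "real \<Rightarrow> real"
  assumes "(f has_real_derivative d) (at x)" "\<And>y. x \<le> y \<Longrightarrow> f y - f x \<le> m * (y - x)"
  shows "d \<le> m"
proof (rule ccontr)
  assume "\<not> d \<le> m"
  have "((\<lambda>y. f y - m * y) has_real_derivative d - m) (at x)"
    by (auto intro!: derivative_eq_intros assms(1))
  from DERIV_pos_inc_right[OF this] \<open>\<not> d \<le> m\<close>
  obtain e where "e > 0" "\<And>h. 0 < h \<Longrightarrow> h < e \<Longrightarrow> f x - m * x < f (x + h) - m * (x + h)"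
    by auto
  from this(2)[of "e / 2"] this(1) assms(2)[of "x + e / 2"] show False
    by (simp add: algebra_simps)
qed

text \<open>A function whose slope is bounded above by a negative constant is unbounded below.\<close>

lemma bounded_imp_DERIV_bound_nonneg:
  fixes f :: "real \<Rightarrow> real"
  assumes "\<And>x. (f has_real_derivative f' x) (at x)" "\<And>x. f' x \<le> m" and B: "\<And>x. \<bar>f x\<bar> \<le> B"
  shows "0 \<le> m"
proof (rule ccontr)
  assume "\<not> 0 \<le> m"
  have "B \<ge> 0" using B[of 0] by linarith
  define x where "x = (2 * B + 1) / - m"
  have "0 \<le> x" "m * x = - (2 * B + 1)"
    using \<open>\<not> 0 \<le> m\<close> \<open>B \<ge> 0\<close> by (auto simp: x_def field_simps)
  with slope_le_of_DERIV_le[OF assms(1,2), of 0 x] B[of x] B[of 0] show False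
    by (simp add: abs_le_iff)
qed

lemma DERIV_riemann_invariants:
  assumes K: "K > 0" "\<gamma> > 1" and sol: "euler_solution K \<gamma> T u \<tau>" and t: "t \<in> time_dom T"
  shows "((\<lambda>\<xi>. u \<xi> t + eta K \<gamma> (\<tau> \<xi> t)) has_real_derivative
      alpha K \<gamma> (\<lambda>\<xi>. u \<xi> t) (\<lambda>\<xi>. \<tau> \<xi> t) x) (at x)"
    and "((\<lambda>\<xi>. u \<xi> t - eta K \<gamma> (\<tau> \<xi> t)) has_real_derivative
      beta K \<gamma> (\<lambda>\<xi>. u \<xi> t) (\<lambda>\<xi>. \<tau> \<xi> t) x) (at x)"
proof -
  have C1: "C1_strip T u" "C1_strip T \<tau>" using sol by (auto simp: euler_solution_def)
  note du = C1_stripD(1)[OF C1(1) t, of x]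
  note dh = DERIV_chain2[OF DERIV_eta[OF K euler_solutionD(1)[OF K sol t]]
      C1_stripD(1)[OF C1(2) t, of x]]
  show "((\<lambda>\<xi>. u \<xi> t + eta K \<gamma> (\<tau> \<xi> t)) has_real_derivative
      alpha K \<gamma> (\<lambda>\<xi>. u \<xi> t) (\<lambda>\<xi>. \<tau> \<xi> t) x) (at x)"
    using DERIV_add[OF du dh] by (simp add: alpha_def DERIV_imp_deriv[OF du] DERIV_imp_deriv[OF dh])
  show "((\<lambda>\<xi>. u \<xi> t - eta K \<gamma> (\<tau> \<xi> t)) has_real_derivative
      beta K \<gamma> (\<lambda>\<xi>. u \<xi> t) (\<lambda>\<xi>. \<tau> \<xi> t) x) (at x)"
    using DERIV_diff[OF du dh] by (simp add: beta_def DERIV_imp_deriv[OF du] DERIV_imp_deriv[OF dh])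
qed

lemma Dx_velocity_le:
  assumes K: "K > 0" "\<gamma> > 1" and sol: "euler_solution K \<gamma> T u \<tau>" and t: "t \<in> time_dom T"
    and \<delta>: "0 < \<delta>" "\<And>x s. s \<in> time_dom T \<Longrightarrow> \<delta> \<le> \<tau> x s"
    and m: "0 \<le> m"
      "\<And>x. alpha K \<gamma> (\<lambda>\<xi>. u \<xi> 0) (\<lambda>\<xi>. \<tau> \<xi> 0) x \<le> m"
      "\<And>x. beta K \<gamma> (\<lambda>\<xi>. u \<xi> 0) (\<lambda>\<xi>. \<tau> \<xi> 0) x \<le> m"
  shows "Dx u x t \<le> m"
proof (rule DERIV_le_of_slope_le)
  have t0: "0 \<le> t" using t by (simp add: time_dom_def)
  have J: "s \<in> time_dom T" if "0 \<le> s" "s \<le> t" for s using time_dom_downward[OF t] that by auto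
  note d0 = DERIV_riemann_invariants[OF K sol J[OF order_refl t0]]
  show "((\<lambda>\<xi>. u \<xi> t) has_real_derivative Dx u x t) (at x)"
    using sol t by (auto simp: euler_solution_def intro: C1_stripD(1))
  fix y assume "x \<le> y"
  note slopes = transported_pair_slope_le[OF riemann_invariants_transported[OF K sol t]
      t0 order_refl sound_speed_nonneg[OF K, of \<delta>] _ _ m(1)
      slope_le_of_DERIV_le[OF d0(1) m(2)] slope_le_of_DERIV_le[OF d0(2) m(3)] \<open>x \<le> y\<close>]
  have speed: "\<bar>sound_speed K \<gamma> (\<tau> x s)\<bar> \<le> sound_speed K \<gamma> \<delta>" if "0 \<le> s" "s \<le> t" for x s
    using sound_speed_antimono[OF K \<delta>(1) \<delta>(2)[OF J[OF that]]] sound_speed_nonneg[OF K]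
    by (simp add: abs_of_nonneg)
  have mono: "sound_speed K \<gamma> (\<tau> x s) \<le> sound_speed K \<gamma> (\<tau> y s)"
    if s: "0 \<le> s" "s \<le> t" and le: "u x s + eta K \<gamma> (\<tau> x s) - (u x s - eta K \<gamma> (\<tau> x s))
      \<le> u y s + eta K \<gamma> (\<tau> y s) - (u y s - eta K \<gamma> (\<tau> y s))" for x y s
  proof -
    note pos = euler_solutionD(1)[OF K sol J[OF s]]
    have "eta K \<gamma> (\<tau> x s) \<le> eta K \<gamma> (\<tau> y s)" using le by simp
    then show ?thesis
      using eta_le_iff[OF K pos pos] sound_speed_antimono[OF K pos] by blast
  qed
  from slopes[OF speed mono] show "u y t - u x t \<le> m * (y - x)" by simp
qed

section \<open>Eulerian coordinates\<close>

text \<open>The lower bound \<open>\<delta>\<close> makes the coordinate map onto, so that \<open>X\<close> is a two-sided inverse on the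
  whole line; positivity of \<open>v\<close> alone would not exclude a range bounded on one side.\<close>

lemma Dx_to_eulerian:
  assumes Y: "\<And>x. ((\<lambda>\<xi>. Y \<xi> t) has_real_derivative v x) (at x)"
    and \<delta>: "0 < \<delta>" "\<And>x. \<delta> \<le> v x"
    and f: "\<And>x. ((\<lambda>\<xi>. f \<xi> t) has_real_derivative Dx f x t) (at x)"
  defines "X \<equiv> inv (\<lambda>x. Y x t)"
  shows "Dx (to_eulerian Y f) y t = Dx f (X y) t / v (X y)"
proof -
  let ?Y = "\<lambda>x. Y x t"
  have pos: "v x > 0" for x using \<delta>(1) \<delta>(2)[of x] by linarith
  have "?Y x < ?Y x'" if "x < x'" for x x'
    using DERIV_pos_imp_increasing[OF that, of ?Y] Y pos by blast
  then have inj: "inj ?Y" by (intro linorder_injI) (auto simp: less_le)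
  have cont: "continuous_on A ?Y" for A
    by (rule DERIV_continuous_on) (use Y in \<open>auto intro: DERIV_subset\<close>)
  have grow: "\<delta> * (x' - x) \<le> ?Y x' - ?Y x" if "x \<le> x'" for x x'
    using slope_le_of_DERIV_le[OF DERIV_minus[OF Y], of "- \<delta>" x x'] \<delta>(2) that by simp
  have "\<exists>x. ?Y x = y" for y
  proof -
    define R where "R = \<bar>y - ?Y 0\<bar> / \<delta>"
    have "0 \<le> R" "\<delta> * R = \<bar>y - ?Y 0\<bar>" using \<delta>(1) by (auto simp: R_def)
    with grow[of 0 R] grow[of "- R" 0] have "?Y (- R) \<le> y" "y \<le> ?Y R" "- R \<le> R" by auto
    then show ?thesis using IVT'[of ?Y "- R" y R] cont by auto
  qed
  then have YX: "?Y (X y) = y" for y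
    unfolding X_def by (intro f_inv_into_f) (auto simp: image_iff, metis)
  have "(X has_derivative (\<lambda>h. h / v (X y))) (at (?Y (X y)))"
  proof (rule has_derivative_inverse_strong[OF open_UNIV UNIV_I cont])
    show "X (?Y x) = x" for x unfolding X_def by (rule inv_f_f[OF inj])
    show "(?Y has_derivative (*) (v (X y))) (at (X y))"
      using Y by (simp add: has_field_derivative_def)
    show "(*) (v (X y)) \<circ> (\<lambda>h. h / v (X y)) = id"
      using pos[of "X y"] by (auto simp: fun_eq_iff)
  qed
  then have "(X has_real_derivative 1 / v (X y)) (at y)"
    unfolding YX by (rule has_derivative_imp_has_field_derivative) simp
  from DERIV_chain2[OF f this]
  show ?thesis
    unfolding Dx_def[of "to_eulerian Y f"] to_eulerian_def X_def
    by (intro DERIV_imp_deriv) (simp add: X_def)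
qed

section \<open>The bounds for \<open>u\<^sub>y / \<rho>\<close> and \<open>u\<^sub>y\<close>\<close>

theorem mainTheorem3:
  fixes K \<gamma> M :: real and u0 \<tau>0 :: "real \<Rightarrow> real"
  assumes "K > 0" and "\<gamma> > 1"
    and "\<And>x. \<tau>0 x > 0"
    and "bounded (range u0)"
    and "bounded (range \<tau>0)"
    and "bounded (range (\<lambda>x. 1 / \<tau>0 x))"
    and "bounded (range (alpha K \<gamma> u0 \<tau>0))"
    and "bounded (range (beta K \<gamma> u0 \<tau>0))"
    and "(SUP x. ereal (max (alpha K \<gamma> u0 \<tau>0 x) (beta K \<gamma> u0 \<tau>0 x))) < ereal M"
  shows "\<exists>Mbar :: real. \<forall>(T :: ereal) (u :: real \<Rightarrow> real \<Rightarrow> real) (\<tau> :: real \<Rightarrow> real \<Rightarrow> real)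
            (Y :: real \<Rightarrow> real \<Rightarrow> real).
      0 < T \<longrightarrow> euler_solution K \<gamma> T u \<tau> \<longrightarrow>
      (\<forall>x. u x 0 = u0 x) \<longrightarrow> (\<forall>x. \<tau> x 0 = \<tau>0 x) \<longrightarrow>
      eulerian_coordinate T u \<tau> Y \<longrightarrow>
      (SUP (y, t)\<in>UNIV \<times> time_dom T.
         ereal (Dx (to_eulerian Y u) y t / to_eulerian Y (\<lambda>x t. 1 / \<tau> x t) y t)) < ereal M \<and>
      (SUP (y, t)\<in>UNIV \<times> time_dom T. ereal (Dx (to_eulerian Y u) y t)) < ereal Mbar"
proof -
  note K = assms(1,2)
  \<comment> \<open>The gap between the supremum and \<open>M\<close> leaves room for the strict inequality of the conclusion.\<close>
  obtain m where m: "(SUP x. ereal (max (alpha K \<gamma> u0 \<tau>0 x) (beta K \<gamma> u0 \<tau>0 x))) < ereal m"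
      "m < M"
    using ereal_dense2[OF assms(9)] by auto
  have grad: "alpha K \<gamma> u0 \<tau>0 x \<le> m" "beta K \<gamma> u0 \<tau>0 x \<le> m" for x
    using SUP_lessD[OF m(1), of x] by simp_all
  obtain B where B: "\<And>x. \<bar>u0 x\<bar> \<le> B" using assms(4) by (auto simp: bounded_iff)
  obtain D where "\<And>x. \<bar>1 / \<tau>0 x\<bar> \<le> D" using assms(6) by (auto simp: bounded_iff)
  then have D: "1 / \<tau>0 x \<le> D" for x by (meson abs_le_iff)
  have "0 < D" using D[of 0] assms(3)[of 0] by (meson less_le_trans zero_less_divide_1_iff)
  define E where "E = eta K \<gamma> (1 / D)"
  have "1 / D \<le> \<tau>0 x" for x
    using D[of x] assms(3)[of x] \<open>0 < D\<close> by (simp add: field_simps)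
  then have E: "eta K \<gamma> (\<tau>0 x) \<le> E" for x
    unfolding E_def using eta_le_iff[OF K] assms(3) \<open>0 < D\<close> by simp
  have "0 \<le> B" "0 < E" using B[of 0] eta_pos[OF K, of "1 / D"] \<open>0 < D\<close> by (auto simp: E_def)
  then obtain \<delta> where \<delta>: "0 < \<delta>" "eta K \<gamma> \<delta> = (B + E) + 1"
    using eta_surj[OF K, of "(B + E) + 1"] by auto
  show ?thesis
  proof (intro exI[of _ "m / \<delta> + 1"] allI impI)
    fix T u \<tau> Y
    assume T: "0 < (T :: ereal)" and sol: "euler_solution K \<gamma> T u \<tau>"
      and init: "\<forall>x. u x 0 = u0 x" "\<forall>x. \<tau> x 0 = \<tau>0 x" and Y: "eulerian_coordinate T u \<tau> Y"
    have zero: "0 \<in> time_dom T" using T by (simp add: time_dom_def zero_ereal_def)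
    have init_eq: "(\<lambda>\<xi>. u \<xi> 0) = u0" "(\<lambda>\<xi>. \<tau> \<xi> 0) = \<tau>0" using init by auto
    have "\<bar>u x 0 + eta K \<gamma> (\<tau> x 0)\<bar> \<le> B + E" for x
      using B[of x] E[of x] eta_pos[OF K assms(3), of x] init by (auto simp: abs_le_iff)
    then have m0: "0 \<le> m"
      using bounded_imp_DERIV_bound_nonneg[OF DERIV_riemann_invariants(1)[OF K sol zero]] grad(1)
      by (auto simp: init_eq)
    have \<tau>_ge: "\<delta> \<le> \<tau> x t" if "t \<in> time_dom T" for x t
    proof (rule specific_volume_lower_bound[OF K sol that _ _ \<delta>])
      show "u x 0 + eta K \<gamma> (\<tau> x 0) \<le> B + E" "eta K \<gamma> (\<tau> x 0) - u x 0 \<le> B + E" for x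
        using B[of x] E[of x] init by (simp_all add: abs_le_iff)
    qed
    have ux: "Dx u x t \<le> m" if "t \<in> time_dom T" for x t
      using Dx_velocity_le[OF K sol that \<delta>(1) \<tau>_ge m0] grad by (simp add: init_eq)
    have uy: "Dx (to_eulerian Y u) y t =
        Dx u (inv (\<lambda>x. Y x t) y) t / \<tau> (inv (\<lambda>x. Y x t) y) t" if "t \<in> time_dom T" for y t
      using Y sol that \<tau>_ge[OF that]
      by (intro Dx_to_eulerian[OF _ \<delta>(1)] C1_stripD(1))
        (auto simp: eulerian_coordinate_def euler_solution_def)
    have "Dx (to_eulerian Y u) y t / to_eulerian Y (\<lambda>x t. 1 / \<tau> x t) y t \<le> m"
      if "t \<in> time_dom T" for y t
      using ux[OF that] \<delta>(1) \<tau>_ge[OF that, of "inv (\<lambda>x. Y x t) y"]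
      by (simp add: uy[OF that] to_eulerian_def)
    then have "(SUP (y, t)\<in>UNIV \<times> time_dom T.
        ereal (Dx (to_eulerian Y u) y t / to_eulerian Y (\<lambda>x t. 1 / \<tau> x t) y t)) \<le> ereal m"
      by (intro SUP_least) auto
    moreover have "Dx (to_eulerian Y u) y t \<le> m / \<delta>" if "t \<in> time_dom T" for y t
      unfolding uy[OF that] using ux[OF that] m0 \<delta>(1) \<tau>_ge[OF that] by (intro frac_le)
    then have "(SUP (y, t)\<in>UNIV \<times> time_dom T. ereal (Dx (to_eulerian Y u) y t)) \<le> ereal (m / \<delta>)"
      by (intro SUP_least) auto
    moreover have "ereal m < ereal M" "ereal (m / \<delta>) < ereal (m / \<delta> + 1)" using m(2) by simp_all
    ultimately show "(SUP (y, t)\<in>UNIV \<times> time_dom T.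
         ereal (Dx (to_eulerian Y u) y t / to_eulerian Y (\<lambda>x t. 1 / \<tau> x t) y t)) < ereal M \<and>
      (SUP (y, t)\<in>UNIV \<times> time_dom T. ereal (Dx (to_eulerian Y u) y t)) < ereal (m / \<delta> + 1)"
      by (blast intro: le_less_trans)
  qed
qed

end
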